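(* Let $A\in\mathbb{R}^{n\times n}$ be symmetric positive definite and $r\in\mathbb{R}^n$. Let $y$ be the result of one cycle of the finite-precision two-grid correction scheme (described, with its rounding error model, in the context) applied to $Ay=r$ with zero initial guess. Then $$\|y-A^{-1}r\|_A\le\rho_{tg}\,\|A^{-1}r\|_A,\qquad \rho_{tg}=\rho_{tg}^*+\delta_{\rho_{tg}},$$ provided $\dot\tau$ is small enough that $\delta_{\rho_{tg}}<1-\rho_{tg}^*$, where $$\delta_{\rho_{tg}}=4\dot\tau+(2+\beta)\dot\mu+\varphi,\qquad \varphi=2\dot\tau^2+(4+\beta)\dot\mu\dot\tau+2\dot\mu\dot\tau^2,$$ $$\dot\mu=3\,\dot\zeta\,\kappa^{1/2}(P^tP)\,\dot m_P^+\,\dot\tau,\qquad \beta=2+3\sigma+2\dot m_A^+(1+\sigma).$$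
   Context: Norms: $\|\cdot\|$ is the Euclidean vector norm and its induced matrix norm; for an SPD matrix $S$, $\|x\|_S=\|S^{1/2}x\|$ with induced matrix norm also written $\|\cdot\|_S$. $|\cdot|$ is entrywise and vector inequalities are entrywise. $\kappa(\cdot)$ is the Euclidean-norm condition number. Setting: $A$ is SPD with at most $m_A$ nonzeros per row. $M\in\mathbb{R}^{n\times n}$ is nonsingular, $G=I-MA$, and $\|G\|_A<1$. $P\in\mathbb{R}^{n\times n_c}$, $n_c<n$, has full rank with at most $m_P$ nonzero entries per row or column, all of which are positive. $A_c=P^tAP$, $T=I-PA_c^{-1}P^tA$, and $\|TG\|_A<1$. $B_c\in\mathbb{R}^{n_c\times n_c}$ satisfies $\|B_c-I_c\|_{A_c}<1$ ($I_c$ the coarse identity). The number $\rho_{tg}^*\in[0,1)$ satisfies $\|(I-PB_cA_c^{-1}P^tA)G\|_A\le\rho_{tg}^*$. All these matrices are exact. Precisions: $\dot\varepsilon\in(0,1)$ is the fine-level unit roundoff and $\dot\varepsilon_c=\dot\zeta\dot\varepsilon\in(0,1)$, $\dot\zeta\ge1$, the coarse-level one; $(m_A+1)\dot\varepsilon<1$ and $m_P\dot\varepsilon<1$. Parameters: $\dot\tau=\kappa^{1/2}(A)\dot\varepsilon$, $\psi=\|\,|A|\,\|$, $\dot m_P^+=\dfrac{m_P}{1-m_P\dot\varepsilon}$, $\dot m_A^+=\dfrac{m_A+1}{1-(m_A+1)\dot\varepsilon}$. $\alpha_M$ is a constant such that computing $Mz$ in $\dot\varepsilon$-precision, for any $z\in\mathbb{R}^n$,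 gives $Mz+\delta_M$ with $\|\delta_M\|\le\alpha_M\dot\varepsilon\|z\|$. $\sigma$ is any constant with $\sigma\ge(1+\dot\varepsilon)\max\{\alpha_M\|A\|,\ \psi\alpha_M,\ \psi\|M\|\}$. Two-grid cycle with rounding error model: (1) round the right-hand side: $r^{(0)}=r+\delta_0$, $\|\delta_0\|\le\dot\varepsilon\|r\|$; (2) relax from zero: $y^{(1/2)}=Mr^{(0)}+\delta_M$, $\|\delta_M\|\le\alpha_M\dot\varepsilon\|r^{(0)}\|$; (3) residual: $r_{tg}=Ay^{(1/2)}-r^{(0)}+\delta_1$, $|\delta_1|\le\dot m_A^+\dot\varepsilon\,(|r^{(0)}|+|A|\,|y^{(1/2)}|)$; (4) restriction: $b_c=P^tr_{tg}+\delta_3$, $|\delta_3|\le(\dot\varepsilon_c+(1+\dot\varepsilon_c)\dot m_P^+\dot\varepsilon)\,P^t|r_{tg}|$; (5) exact coarse solve: $d_c=B_cA_c^{-1}b_c$; (6) interpolation: $d=Pd_c+\delta_5$, $|\delta_5|\le\dot m_P^+\dot\varepsilon_c\,P|d_c|$; (7) update: each component of $y$ equals the corresponding component of $y^{(1/2)}-d$ times a factor $1+\delta_4$ with $|\delta_4|\le\dot\varepsilon$. *)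

theory Defs
  imports "HOL-Analysis.Analysis"
begin

definition spd :: "real^'n^'n \<Rightarrow> bool" where
  "spd S \<longleftrightarrow> transpose S = S \<and> (\<forall>x. x \<noteq> 0 \<longrightarrow> x \<bullet> (S *v x) > 0)"

(* The principal square root S^{1/2}. An SPD matrix has exactly one SPD square root;
   for other matrices the value is unspecified and never used. *)
definition spd_sqrt :: "real^'n^'n \<Rightarrow> real^'n^'n" where
  "spd_sqrt S = (THE R. spd R \<and> R ** R = S)"

definition energy_norm :: "real^'n^'n \<Rightarrow> real^'n \<Rightarrow> real" where
  "energy_norm S x = norm (spd_sqrt S *v x)"

(* Same pattern as onorm: x = 0 contributes 0 / 0 = 0 to the supremum. *)
definition energy_opnorm :: "real^'n^'n \<Rightarrow> real^'n^'n \<Rightarrow> real" where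
  "energy_opnorm S B = (SUP x. energy_norm S (B *v x) / energy_norm S x)"

abbreviation opnorm :: "real^'n^'m \<Rightarrow> real" where
  "opnorm B \<equiv> onorm ((*v) B)"

definition cond_num :: "real^'n^'n \<Rightarrow> real" where
  "cond_num S = opnorm S * opnorm (matrix_inv S)"

definition row_nonzeros_le :: "nat \<Rightarrow> real^'n^'m \<Rightarrow> bool" where
  "row_nonzeros_le k B \<longleftrightarrow> (\<forall>i. card {j. B $ i $ j \<noteq> 0} \<le> k)"

(* The rounding error constant of inner products with k terms at unit roundoff eps,
   divided by eps. *)
definition round_const :: "nat \<Rightarrow> real \<Rightarrow> real" where
  "round_const k eps = real k / (1 - real k * eps)"

(* "two_grid_cycle A P Bc flM mA mP eps epsc r y": y is a possible result of one cycle for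
   A y = r with zero initial guess, at fine and coarse unit roundoffs eps and epsc. The function
   flM returns the computed value of M z. On vectors, absolute value and the order
   are entrywise, and "transpose P" and "P" act on entrywise absolute values directly because the
   entries of P are nonnegative. *)
definition two_grid_cycle ::
  "real^'n^'n \<Rightarrow> real^'c^'n \<Rightarrow> real^'c^'c \<Rightarrow> (real^'n \<Rightarrow> real^'n) \<Rightarrow> nat \<Rightarrow> nat \<Rightarrow> real \<Rightarrow> real
    \<Rightarrow> real^'n \<Rightarrow> real^'n \<Rightarrow> bool" where
  "two_grid_cycle A P Bc flM mA mP eps epsc r y \<longleftrightarrow>
    (\<exists>r0 yh rtg bc dc d \<delta>0 \<delta>1 \<delta>3 \<delta>4 \<delta>5.
      r0 = r + \<delta>0 \<and> norm \<delta>0 \<le> eps * norm r \<and>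
      yh = flM r0 \<and>
      rtg = A *v yh - r0 + \<delta>1 \<and>
        \<bar>\<delta>1\<bar> \<le> (round_const (mA + 1) eps * eps) *\<^sub>R (\<bar>r0\<bar> + \<bar>A\<bar> *v \<bar>yh\<bar>) \<and>
      bc = transpose P *v rtg + \<delta>3 \<and>
        \<bar>\<delta>3\<bar> \<le> (epsc + (1 + epsc) * round_const mP eps * eps) *\<^sub>R (transpose P *v \<bar>rtg\<bar>) \<and>
      dc = Bc *v (matrix_inv (transpose P ** A ** P) *v bc) \<and>
      d = P *v dc + \<delta>5 \<and>
        \<bar>\<delta>5\<bar> \<le> (round_const mP eps * epsc) *\<^sub>R (P *v \<bar>dc\<bar>) \<and>
      (\<forall>i. y $ i = (yh - d) $ i * (1 + \<delta>4 $ i) \<and> \<bar>\<delta>4 $ i\<bar> \<le> eps))"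

end

theory Submission
  imports Defs
begin

text \<open>
  With \<open>x\<^sub>0 = A\<^sup>-\<^sup>1 r\<^sub>0\<close> and \<open>K = I - P B\<^sub>c A\<^sub>c\<^sup>-\<^sup>1 P\<^sup>t A\<close>, the error before the final update is
  \<open>e = - K G x\<^sub>0 + (x\<^sub>0 - x) + K \<delta>\<^sub>M - P B\<^sub>c A\<^sub>c\<^sup>-\<^sup>1 P\<^sup>t \<delta>\<^sub>1 - P B\<^sub>c A\<^sub>c\<^sup>-\<^sup>1 \<delta>\<^sub>3 - \<delta>\<^sub>5\<close>.
  Measuring every term in the energy norm, where \<open>A\<^sub>c\<^sup>-\<^sup>1 P\<^sup>t A\<close> is a contraction and \<open>B\<^sub>c\<close> at most
  doubles norms, gives \<open>\<parallel>e\<parallel> \<le> (\<rho>* + 2\<tau> + (2 + \<beta> + 2\<tau>) \<mu>) \<parallel>x\<parallel>\<close>: the terms of second order are absorbed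
  because \<open>(2 + \<beta>) \<mu> < 1\<close> and \<open>3\<epsilon> \<le> 3\<tau> \<le> \<mu>\<close>. The update contributes \<open>\<tau> \<parallel>e + x\<parallel>\<close>.
  The energy norm is accessible once the spectral theorem has shown that \<open>spd_sqrt\<close> is well defined,
  so that \<open>\<parallel>x\<parallel>\<^sup>2 = x \<bullet> A x\<close>.
\<close>

lemma inner_transpose_mult:
  fixes B :: "real^'n^'m"
  shows "(transpose B *v x) \<bullet> y = x \<bullet> (B *v y)"
  by (simp add: dot_lmul_matrix)

lemma spd_inner_commute:
  assumes "spd S"
  shows "(S *v x) \<bullet> y = x \<bullet> (S *v y)"
  using assms inner_transpose_mult[of S x y] by (simp add: spd_def)

lemma spd_inner_nonneg: "spd S \<Longrightarrow> 0 \<le> x \<bullet> (S *v x)"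
  by (cases "x = 0") (auto simp: spd_def less_imp_le)

subsection \<open>Spectral theorem and square roots\<close>

text \<open>The form \<open>q x = l (x \<bullet> x) - x \<bullet> f x\<close> is positive semidefinite on \<open>V\<close> and vanishes at \<open>v\<close>, so its
  polar form vanishes on \<open>v\<close> and \<open>w = l v - f v\<close>, which gives \<open>w \<bullet> w = 0\<close>.\<close>

lemma symmetric_maximizer_is_eigenvector:
  fixes f :: "'a::euclidean_space \<Rightarrow> 'a"
  assumes lin: "linear f" and sym: "\<And>x y. f x \<bullet> y = x \<bullet> f y"
    and V: "subspace V" "f ` V \<subseteq> V" and v: "v \<in> V" "norm v = 1"
    and max: "\<And>x. x \<in> V \<Longrightarrow> norm x = 1 \<Longrightarrow> x \<bullet> f x \<le> v \<bullet> f v"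
  shows "f v = (v \<bullet> f v) *\<^sub>R v"
proof -
  interpret f: linear f by (rule lin)
  define l where "l = v \<bullet> f v"
  define q where "q x = l * (x \<bullet> x) - x \<bullet> f x" for x
  have q_nonneg: "0 \<le> q x" if "x \<in> V" for x
  proof (cases "x = 0")
    case False
    define u where "u = x /\<^sub>R norm x"
    have u: "u \<in> V" "norm u = 1" and x: "x = norm x *\<^sub>R u"
      using False that V(1) by (auto simp: u_def subspace_scale)
    have "q (k *\<^sub>R u) = k\<^sup>2 * q u" for k
      by (simp add: q_def f.scale power2_eq_square algebra_simps)
    then have "q x = (norm x)\<^sup>2 * q u"
      using x by metis
    moreover have "0 \<le> q u"
      using max[OF u] u by (simp add: q_def l_def dot_square_norm)
    ultimately show ?thesis by simp
  qed (simp add: q_def)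
  define w where "w = l *\<^sub>R v - f v"
  define c where "c = q w"
  have w: "w \<in> V"
    using V v by (auto simp: w_def subspace_scale subspace_diff image_subset_iff)
  have vv: "v \<bullet> v = 1" using v by (simp add: dot_square_norm)
  have c: "0 \<le> c" using q_nonneg[OF w] by (simp add: c_def)
  have quad: "q (v + t *\<^sub>R w) = 2 * t * (w \<bullet> w) + t\<^sup>2 * c" for t
  proof -
    have "v \<bullet> f w = f v \<bullet> w" "w \<bullet> f v = f v \<bullet> w"
      by (simp_all only: sym inner_commute[of w])
    then have "q (v + t *\<^sub>R w) = q v + 2 * t * (l * (v \<bullet> w) - f v \<bullet> w) + t\<^sup>2 * c"
      by (simp add: q_def c_def f.add f.scale inner_add_left inner_add_right
          inner_commute[of w v] power2_eq_square algebra_simps)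
    moreover have "l * (v \<bullet> w) - f v \<bullet> w = w \<bullet> w"
      by (subst (3) w_def) (simp add: inner_diff_left)
    moreover have "q v = 0" by (simp add: q_def l_def vv)
    ultimately show ?thesis by simp
  qed
  have "w \<bullet> w = 0"
  proof (rule ccontr)
    assume "w \<bullet> w \<noteq> 0"
    define s where "s = w \<bullet> w"
    have s: "0 < s" using \<open>w \<bullet> w \<noteq> 0\<close> by (simp add: s_def)
    \<comment> \<open>The parabola has its vertex at -s/c when c is positive; the denominator c + 1
      also covers c = 0 and still makes the value negative.\<close>
    define t where "t = - s / (c + 1)"
    have "0 \<le> q (v + t *\<^sub>R w)"
      using V v w by (intro q_nonneg) (auto intro: subspace_add subspace_scale)
    then have "0 \<le> 2 * t * s + t\<^sup>2 * c" by (simp add: quad s_def)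
    also have "\<dots> = - (s\<^sup>2 * (c + 2)) / (c + 1)\<^sup>2"
    proof -
      have "2 * t * s = - (2 * s\<^sup>2 * (c + 1)) / (c + 1)\<^sup>2"
        using c by (simp add: t_def power2_eq_square)
      moreover have "t\<^sup>2 * c = s\<^sup>2 * c / (c + 1)\<^sup>2"
        by (simp add: t_def power_divide)
      ultimately show ?thesis
        by (simp only: flip: add_divide_distrib) (simp add: algebra_simps)
    qed
    also have "\<dots> < 0" using c s by (intro divide_neg_pos) (auto intro!: mult_pos_pos)
    finally show False by simp
  qed
  then show ?thesis by (simp add: w_def l_def)
qed

text \<open>Induction on the dimension: a maximizer v of x . f x over the unit sphere of
  \<open>V\<close> is an eigenvector, and symmetry keeps the orthogonal complement of v in
  \<open>V\<close> invariant. Admitting every invariant subspace lets the induction continue on that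
  complement.\<close>

lemma symmetric_orthonormal_eigenbasis:
  fixes f :: "'a::euclidean_space \<Rightarrow> 'a"
  assumes lin: "linear f" and sym: "\<And>x y. f x \<bullet> y = x \<bullet> f y"
    and "subspace V" "f ` V \<subseteq> V"
  shows "\<exists>B\<subseteq>V. finite B \<and> pairwise orthogonal B \<and> span B = V \<and>
    (\<forall>b\<in>B. norm b = 1 \<and> f b = (b \<bullet> f b) *\<^sub>R b)"
  using assms(3,4)
proof (induction "dim V" arbitrary: V rule: less_induct)
  case less
  show ?case
  proof (cases "V = {0}")
    case True
    then show ?thesis by (intro exI[of _ "{}"]) auto
  next
    case False
    let ?K = "V \<inter> sphere 0 1"
    obtain x where x: "x \<in> V" "x \<noteq> 0"
      using False less.prems(1) subspace_0 by blast
    have "x /\<^sub>R norm x \<in> ?K" using x less.prems(1) by (auto simp: subspace_scale)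
    then have "?K \<noteq> {}" by blast
    moreover have "compact ?K"
      using closed_subspace[OF less.prems(1)] by (intro closed_Int_compact) auto
    moreover have "continuous_on ?K (\<lambda>x. x \<bullet> f x)"
      by (intro continuous_intros linear_continuous_on linear_linear[THEN iffD2, OF lin])
    ultimately obtain v where v: "v \<in> ?K" "\<And>y. y \<in> ?K \<Longrightarrow> y \<bullet> f y \<le> v \<bullet> f v"
      using continuous_attains_sup by (metis (no_types, lifting))
    have v1: "v \<in> V" "norm v = 1" using v by auto
    have ev: "f v = (v \<bullet> f v) *\<^sub>R v"
      using v by (intro symmetric_maximizer_is_eigenvector[OF lin sym less.prems v1]) auto
    define W where "W = V \<inter> {x. v \<bullet> x = 0}"
    have W: "subspace W" unfolding W_def
      by (intro subspace_inter less.prems(1) subspace_hyperplane)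
    have fW: "f ` W \<subseteq> W"
    proof
      fix y assume "y \<in> f ` W"
      then obtain x where x: "y = f x" "x \<in> V" "v \<bullet> x = 0" by (auto simp: W_def)
      have "v \<bullet> f x = f v \<bullet> x" by (simp add: sym)
      also have "\<dots> = 0" by (subst ev) (simp add: x)
      finally show "y \<in> W" using x less.prems(2) by (auto simp: W_def)
    qed
    have "v \<notin> W" using v1 by (auto simp: W_def dot_square_norm)
    then have "W \<subset> V" using v1 unfolding W_def by blast
    then have "dim W < dim V"
      using W less.prems(1) by (metis dim_psubset span_eq_iff)
    from less.hyps[OF this W fW] obtain B where B: "B \<subseteq> W" "finite B" "pairwise orthogonal B"
      "span B = W" "\<forall>b\<in>B. norm b = 1 \<and> f b = (b \<bullet> f b) *\<^sub>R b" by auto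
    have "V \<subseteq> span (insert v B)"
    proof
      fix x assume x: "x \<in> V"
      have "x - (v \<bullet> x) *\<^sub>R v \<in> W"
        using x v1 less.prems(1)
        by (auto simp: W_def subspace_diff subspace_scale inner_diff_right dot_square_norm)
      then show "x \<in> span (insert v B)" unfolding span_insert using B(4) by blast
    qed
    moreover have "span (insert v B) \<subseteq> V"
      using B(1) v1 less.prems(1) \<open>W \<subset> V\<close> by (intro span_minimal) auto
    moreover have "pairwise orthogonal (insert v B)"
      using B(1,3) by (auto simp: pairwise_insert orthogonal_def W_def inner_commute)
    ultimately show ?thesis
      using B v1 ev \<open>W \<subset> V\<close> by (intro exI[of _ "insert v B"]) auto
  qed
qed

text \<open>In an orthonormal eigenbasis of \<open>S\<close>, the root \<open>R\<close> scales each
  basis vector b by the square root of its eigenvalue b . S b.\<close>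

lemma spd_sqrt_exists:
  fixes S :: "real^'n^'n"
  assumes S: "spd S"
  shows "\<exists>R. spd R \<and> R ** R = S"
proof -
  obtain B :: "(real^'n) set" where B: "finite B" "pairwise orthogonal B" "span B = UNIV"
    "\<And>b. b \<in> B \<Longrightarrow> norm b = 1" "\<And>b. b \<in> B \<Longrightarrow> S *v b = (b \<bullet> (S *v b)) *\<^sub>R b"
    using symmetric_orthonormal_eigenbasis[of "(*v) S" UNIV] spd_inner_commute[OF S] by auto
  define m where "m b = sqrt (b \<bullet> (S *v b))" for b
  define g where "g x = (\<Sum>b\<in>B. (m b * (b \<bullet> x)) *\<^sub>R b)" for x
  define R where "R = matrix g"
  have m: "0 < m b" if "b \<in> B" for b
    using B(4)[OF that] S norm_zero unfolding m_def spd_def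
    by (metis real_sqrt_gt_0_iff zero_neq_one)
  have "linear g"
    unfolding g_def
    by (intro linear_compose_sum ballI linearI)
      (auto simp: inner_add_right algebra_simps)
  then have Rg: "R *v x = g x" for x by (simp add: R_def)
  have gb: "g b = m b *\<^sub>R b" if b: "b \<in> B" for b
  proof -
    have "g b = (\<Sum>c\<in>B. if c = b then m b *\<^sub>R b else 0)"
      unfolding g_def using B(2) B(4)[OF b] b
      by (intro sum.cong) (auto simp: pairwise_def orthogonal_def dot_square_norm)
    then show ?thesis using B(1) b by simp
  qed
  have "(R ** R) *v x = S *v x" for x
  proof (rule linear_eq_on_span[of "(*v) (R ** R)" "(*v) S" B])
    fix b assume b: "b \<in> B"
    have "(R ** R) *v b = (m b * m b) *\<^sub>R b"
      using gb[OF b] by (simp flip: matrix_vector_mul_assoc add: Rg linear_scale[OF \<open>linear g\<close>])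
    also have "\<dots> = S *v b"
      using B(5)[OF b] spd_inner_nonneg[OF S] by (simp add: m_def)
    finally show "(R ** R) *v b = S *v b" .
  qed (use B in auto)
  then have "R ** R = S" by (simp add: matrix_eq)
  moreover have "transpose R = R"
  proof -
    have "x \<bullet> (transpose R *v y) = x \<bullet> (R *v y)" for x y
      using inner_transpose_mult[of R y x]
      by (simp add: Rg g_def inner_sum_left inner_sum_right inner_commute mult_ac)
    then show ?thesis by (metis matrix_eq vector_eq_rdot inner_commute)
  qed
  moreover have "0 < x \<bullet> (R *v x)" if "x \<noteq> 0" for x
  proof -
    have xR: "x \<bullet> (R *v x) = (\<Sum>b\<in>B. m b * (b \<bullet> x)\<^sup>2)"
      by (simp add: Rg g_def inner_sum_right inner_commute power2_eq_square mult_ac)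
    \<comment> \<open>A vector orthogonal to the whole spanning set is orthogonal to itself; hence
      some summand is strictly positive.\<close>
    have "\<exists>b\<in>B. b \<bullet> x \<noteq> 0"
    proof (rule ccontr)
      assume "\<not> ?thesis"
      then have "x \<in> span B \<Longrightarrow> orthogonal x x"
        by (intro orthogonal_to_span[of x B x]) (auto simp: orthogonal_def inner_commute)
      then show False using B(3) that by (simp add: orthogonal_def)
    qed
    then show ?thesis unfolding xR using m B(1)
      by (auto intro!: sum_pos2 simp: less_imp_le)
  qed
  ultimately show ?thesis unfolding spd_def by blast
qed

text \<open>For \<open>R\<^sup>2 = Q\<^sup>2\<close> the difference \<open>D = R - Q\<close> satisfies \<open>R D + D Q = 0\<close>, so an eigenvector \<open>v\<close>
  of \<open>D\<close> with eigenvalue \<open>l\<close> satisfies \<open>l (v \<bullet> R v + v \<bullet> Q v) = 0\<close>.\<close>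

lemma spd_sqrt_unique:
  fixes R Q :: "real^'n^'n"
  assumes R: "spd R" and Q: "spd Q" and eq: "R ** R = Q ** Q"
  shows "R = Q"
proof -
  define f where "f x = R *v x - Q *v x" for x
  have lin: "linear f" unfolding f_def by (intro linear_compose_sub) auto
  have sym: "f x \<bullet> y = x \<bullet> f y" for x y
    by (simp add: f_def inner_diff_left inner_diff_right spd_inner_commute[OF R] spd_inner_commute[OF Q])
  have rel: "R *v f x + f (Q *v x) = 0" for x
    using arg_cong[OF eq, of "\<lambda>X. X *v x"]
    by (simp add: f_def matrix_vector_mult_diff_distrib matrix_vector_mul_assoc)
  obtain B where B: "span B = (UNIV :: (real^'n) set)"
    "\<And>b. b \<in> B \<Longrightarrow> norm b = 1" "\<And>b. b \<in> B \<Longrightarrow> f b = (b \<bullet> f b) *\<^sub>R b"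
    using symmetric_orthonormal_eigenbasis[OF lin sym subspace_UNIV] by auto
  have "f b = 0" if b: "b \<in> B" for b
  proof -
    define l where "l = b \<bullet> f b"
    have fb: "f b = l *\<^sub>R b" using B(3)[OF b] by (simp add: l_def)
    have "0 = b \<bullet> (R *v f b) + b \<bullet> f (Q *v b)"
      by (simp flip: inner_add_right add: rel)
    also have "\<dots> = l * (b \<bullet> (R *v b) + b \<bullet> (Q *v b))"
      by (simp add: fb matrix_vector_mult_scaleR algebra_simps flip: sym)
    finally have "l = 0 \<or> b \<bullet> (R *v b) + b \<bullet> (Q *v b) = 0" by simp
    moreover have "b \<noteq> 0" using B(2)[OF b] by auto
    ultimately have "l = 0"
      using R Q unfolding spd_def by (metis add_pos_pos less_irrefl)
    then show ?thesis by (simp add: fb)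
  qed
  then have "f x = 0" for x
    using linear_eq_on_span[OF lin linear_zero, of B x] B(1) by simp
  then show ?thesis by (simp add: f_def matrix_eq)
qed

lemma spd_sqrt_works:
  assumes "spd S"
  shows "spd (spd_sqrt S)" "spd_sqrt S ** spd_sqrt S = S"
proof -
  have "\<exists>!R. spd R \<and> R ** R = S"
    using spd_sqrt_exists[OF assms] spd_sqrt_unique by blast
  from theI'[OF this] show "spd (spd_sqrt S)" "spd_sqrt S ** spd_sqrt S = S"
    unfolding spd_sqrt_def by auto
qed

subsection \<open>Energy norms\<close>

lemma energy_norm_power2:
  assumes "spd S"
  shows "(energy_norm S x)\<^sup>2 = x \<bullet> (S *v x)"
proof -
  have "(energy_norm S x)\<^sup>2 = x \<bullet> ((spd_sqrt S ** spd_sqrt S) *v x)"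
    using spd_inner_commute[OF spd_sqrt_works(1)[OF assms]]
    by (simp add: energy_norm_def power2_norm_eq_inner flip: matrix_vector_mul_assoc)
  then show ?thesis by (simp add: spd_sqrt_works[OF assms])
qed

lemma energy_norm_nonneg [simp]: "0 \<le> energy_norm S x"
  by (simp add: energy_norm_def)

lemma energy_norm_0 [simp]: "energy_norm S 0 = 0"
  by (simp add: energy_norm_def)

lemma energy_norm_minus [simp]: "energy_norm S (- x) = energy_norm S x"
  using matrix_vector_mult_scaleR[of "spd_sqrt S" "-1" x] by (simp add: energy_norm_def)

lemma energy_norm_add_le: "energy_norm S (x + y) \<le> energy_norm S x + energy_norm S y"
  by (simp add: energy_norm_def matrix_vector_right_distrib norm_triangle_ineq)

lemma energy_norm_diff_le: "energy_norm S (x - y) \<le> energy_norm S x + energy_norm S y"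
  using energy_norm_add_le[of S x "- y"] by simp

lemma energy_norm_eq_sqrt: "spd S \<Longrightarrow> energy_norm S x = sqrt (x \<bullet> (S *v x))"
  by (simp flip: energy_norm_power2)

lemma energy_norm_pos: "spd S \<Longrightarrow> x \<noteq> 0 \<Longrightarrow> 0 < energy_norm S x"
  by (simp add: energy_norm_eq_sqrt spd_def)

text \<open>Cauchy-Schwarz for the images of x and y under the square root of
  \<open>S\<close>.\<close>

lemma energy_inner_le:
  assumes "spd S"
  shows "x \<bullet> (S *v y) \<le> energy_norm S x * energy_norm S y"
proof -
  have "x \<bullet> (S *v y) = x \<bullet> ((spd_sqrt S ** spd_sqrt S) *v y)"
    by (simp add: spd_sqrt_works[OF assms])
  also have "\<dots> = (spd_sqrt S *v x) \<bullet> (spd_sqrt S *v y)"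
    by (simp add: spd_inner_commute[OF spd_sqrt_works(1)[OF assms]] flip: matrix_vector_mul_assoc)
  finally show ?thesis by (simp add: energy_norm_def norm_cauchy_schwarz)
qed

section \<open>Comparison of Euclidean and energy norms\<close>

lemma norm_mult_opnorm_le:
  fixes B :: "real^'n^'m"
  shows "norm (B *v x) \<le> opnorm B * norm x"
  by (intro onorm matrix_vector_mul_bounded_linear)

lemma opnorm_nonneg: "0 \<le> opnorm (B :: real^'n^'m)"
  by (intro onorm_pos_le matrix_vector_mul_bounded_linear)

lemma spd_matrix_inv:
  fixes S :: "real^'n^'n"
  assumes "spd S"
  shows "S *v (matrix_inv S *v x) = x" "matrix_inv S *v (S *v x) = x"
proof -
  have "invertible S"
    using assms unfolding spd_def invertible_left_inverse matrix_left_invertible_ker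
    by (metis inner_zero_right less_irrefl)
  then have "S ** matrix_inv S = mat 1 \<and> matrix_inv S ** S = mat 1"
    unfolding invertible_def matrix_inv_def by (rule someI_ex)
  then show "S *v (matrix_inv S *v x) = x" "matrix_inv S *v (S *v x) = x"
    by (simp_all add: matrix_vector_mul_assoc)
qed

lemma energy_norm_le_norm:
  assumes "spd S"
  shows "energy_norm S x \<le> sqrt (opnorm S) * norm x"
proof -
  have "x \<bullet> (S *v x) \<le> norm x * (opnorm S * norm x)"
    using norm_cauchy_schwarz[of x "S *v x"] norm_mult_opnorm_le[of S x]
    by (meson mult_left_mono norm_ge_zero order_trans)
  then have "(energy_norm S x)\<^sup>2 \<le> (sqrt (opnorm S) * norm x)\<^sup>2"
    using opnorm_nonneg[of S]
    by (simp add: energy_norm_power2[OF assms] power_mult_distrib) (simp add: power2_eq_square mult_ac)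
  then show ?thesis by (rule power2_le_imp_le) (simp add: opnorm_nonneg)
qed

text \<open>The squared energy norm is (\<open>matrix_inv S *v z\<close>) . z, so only the square
  root of the norm of the inverse is lost. Such square roots are why \<tau> contains the root of the
  condition number.\<close>

lemma energy_norm_inv_le_norm:
  assumes "spd S"
  shows "energy_norm S (matrix_inv S *v z) \<le> sqrt (opnorm (matrix_inv S)) * norm z"
proof -
  have "(matrix_inv S *v z) \<bullet> z \<le> (opnorm (matrix_inv S) * norm z) * norm z"
    using norm_cauchy_schwarz[of "matrix_inv S *v z" z] norm_mult_opnorm_le[of "matrix_inv S" z]
    by (meson mult_right_mono norm_ge_zero order_trans)
  then have "(energy_norm S (matrix_inv S *v z))\<^sup>2 \<le> (sqrt (opnorm (matrix_inv S)) * norm z)\<^sup>2"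
    using opnorm_nonneg[of "matrix_inv S"]
    by (simp add: energy_norm_power2[OF assms] spd_matrix_inv[OF assms] power_mult_distrib)
      (simp add: power2_eq_square mult_ac)
  then show ?thesis by (rule power2_le_imp_le) (simp add: opnorm_nonneg)
qed

text \<open>Write v . v as the energy inner product of v and \<open>matrix_inv S *v v\<close>; after
  Cauchy-Schwarz and the previous bound one factor \<open>norm v\<close> cancels.\<close>

lemma norm_le_energy_norm:
  assumes "spd S"
  shows "norm v \<le> sqrt (opnorm (matrix_inv S)) * energy_norm S v"
proof (cases "v = 0")
  case False
  have "norm v * norm v = v \<bullet> (S *v (matrix_inv S *v v))"
    by (simp add: spd_matrix_inv[OF assms] flip: power2_eq_square power2_norm_eq_inner)
  also have "\<dots> \<le> energy_norm S v * (sqrt (opnorm (matrix_inv S)) * norm v)"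
    by (rule order_trans[OF energy_inner_le[OF assms]])
      (intro mult_left_mono energy_norm_inv_le_norm assms energy_norm_nonneg)
  finally show ?thesis using False by (simp add: mult_ac)
qed simp

lemma norm_mult_le_energy_norm:
  assumes "spd S"
  shows "norm (S *v v) \<le> sqrt (opnorm S) * energy_norm S v"
proof (cases "S *v v = 0")
  case False
  have "norm (S *v v) * norm (S *v v) = (S *v v) \<bullet> (S *v v)"
    by (simp flip: power2_eq_square power2_norm_eq_inner)
  also have "\<dots> \<le> energy_norm S (S *v v) * energy_norm S v"
    by (rule energy_inner_le[OF assms])
  also have "\<dots> \<le> (sqrt (opnorm S) * norm (S *v v)) * energy_norm S v"
    by (intro mult_right_mono energy_norm_le_norm assms energy_norm_nonneg)
  finally show ?thesis using False by (simp add: mult_ac)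
qed (simp add: opnorm_nonneg)

text \<open>A real supremum dominates its members only if the set is bounded above; the equivalence
  of Euclidean and energy norms supplies the bound.\<close>

lemma energy_opnorm_bound:
  assumes S: "spd S"
  shows "energy_norm S (B *v x) \<le> energy_opnorm S B * energy_norm S x"
proof (cases "x = 0")
  case False
  have "energy_norm S (B *v x) / energy_norm S x \<le> energy_opnorm S B"
    unfolding energy_opnorm_def
  proof (rule cSUP_upper)
    let ?c = "sqrt (opnorm S) * opnorm B * sqrt (opnorm (matrix_inv S))"
    have "energy_norm S (B *v x) / energy_norm S x \<le> ?c" for x
    proof (cases "x = 0")
      case False
      have "energy_norm S (B *v x) \<le> sqrt (opnorm S) * norm (B *v x)"
        by (rule energy_norm_le_norm[OF S])
      also have "\<dots> \<le> sqrt (opnorm S) * (opnorm B * norm x)"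
        by (intro mult_left_mono norm_mult_opnorm_le) (simp add: opnorm_nonneg)
      also have "\<dots> \<le> sqrt (opnorm S) * (opnorm B * (sqrt (opnorm (matrix_inv S)) * energy_norm S x))"
        by (intro mult_left_mono norm_le_energy_norm S) (simp_all add: opnorm_nonneg)
      finally show ?thesis
        using energy_norm_pos[OF S False] by (simp add: field_simps)
    qed (simp add: opnorm_nonneg)
    then show "bdd_above (range (\<lambda>x. energy_norm S (B *v x) / energy_norm S x))"
      by (intro bdd_aboveI2)
  qed simp
  then show ?thesis using energy_norm_pos[OF S False] by (simp add: field_simps)
qed simp

text \<open>Applying \<open>S\<close> and then its inverse to a unit vector returns it. This later
  gives \<epsilon> \<le> \<tau> and 3\<tau> \<le> \<mu>.\<close>

lemma one_le_cond_num:
  fixes S :: "real^'n^'n"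
  assumes "spd S"
  shows "1 \<le> cond_num S"
proof -
  define v :: "real^'n" where "v = axis undefined 1"
  have "norm v = norm (matrix_inv S *v (S *v v))" by (simp add: spd_matrix_inv[OF assms])
  also have "\<dots> \<le> opnorm (matrix_inv S) * (opnorm S * norm v)"
    by (rule order_trans[OF norm_mult_opnorm_le])
      (intro mult_left_mono norm_mult_opnorm_le opnorm_nonneg)
  finally show ?thesis by (simp add: v_def cond_num_def mult.commute)
qed

subsection \<open>Galerkin coarse operators\<close>

lemma spd_galerkin:
  fixes P :: "real^'c^'n"
  assumes "spd A" "inj ((*v) P)"
  shows "spd (transpose P ** A ** P)"
proof -
  have "transpose (transpose P ** A ** P) = transpose P ** A ** P"
    using assms(1) by (simp add: spd_def matrix_transpose_mul matrix_mul_assoc)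
  moreover have "0 < z \<bullet> ((transpose P ** A ** P) *v z)" if "z \<noteq> 0" for z
  proof -
    have "P *v z \<noteq> 0" using that assms(2) by (metis injD matrix_vector_mult_0_right)
    then show ?thesis
      using assms(1) inner_transpose_mult[of P "A *v (P *v z)" z]
      by (simp add: spd_def inner_commute flip: matrix_vector_mul_assoc)
  qed
  ultimately show ?thesis by (simp add: spd_def)
qed

lemma energy_norm_galerkin:
  fixes P :: "real^'c^'n"
  assumes "spd A" "inj ((*v) P)"
  shows "energy_norm (transpose P ** A ** P) z = energy_norm A (P *v z)"
  using inner_transpose_mult[of P "A *v (P *v z)" z]
  by (simp add: energy_norm_eq_sqrt spd_galerkin assms inner_commute flip: matrix_vector_mul_assoc)

section \<open>The Gram matrix of the interpolation and coarse-level bounds\<close>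

lemma spd_mat_1: "spd (mat 1)"
  by (simp add: spd_def)

lemma energy_norm_mat_1: "energy_norm (mat 1) x = norm x"
  by (simp add: energy_norm_eq_sqrt spd_mat_1 norm_eq_sqrt_inner)

text \<open>The Gram matrix is the Galerkin operator of the identity, so its energy norm of z is the
  Euclidean norm of \<open>P *v z\<close> and the general comparisons apply.\<close>

lemma
  fixes P :: "real^'c^'n"
  assumes "inj ((*v) P)"
  shows spd_gram: "spd (transpose P ** P)"
    and norm_full_rank_le: "norm (P *v z) \<le> sqrt (opnorm (transpose P ** P)) * norm z"
    and norm_le_full_rank: "norm z \<le> sqrt (opnorm (matrix_inv (transpose P ** P))) * norm (P *v z)"
proof -
  show spd: "spd (transpose P ** P)"
    using spd_galerkin[OF spd_mat_1 assms] by simp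
  have "energy_norm (transpose P ** P) z = norm (P *v z)"
    using energy_norm_galerkin[OF spd_mat_1 assms] by (simp add: energy_norm_mat_1)
  then show "norm (P *v z) \<le> sqrt (opnorm (transpose P ** P)) * norm z"
    "norm z \<le> sqrt (opnorm (matrix_inv (transpose P ** P))) * norm (P *v z)"
    using energy_norm_le_norm[OF spd, of z] norm_le_energy_norm[OF spd, of z] by simp_all
qed

text \<open>By duality: the squared norm of w = \<open>transpose P *v v\<close> is v . P w, and the
  bound for \<open>P\<close> leaves one factor \<open>norm w\<close> to cancel.\<close>

lemma norm_transpose_full_rank_le:
  fixes P :: "real^'c^'n"
  assumes "inj ((*v) P)"
  shows "norm (transpose P *v v) \<le> sqrt (opnorm (transpose P ** P)) * norm v"
proof (cases "transpose P *v v = 0")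
  case False
  let ?w = "transpose P *v v"
  have "norm ?w * norm ?w = v \<bullet> (P *v ?w)"
    using inner_transpose_mult[of P v ?w] by (simp flip: power2_eq_square power2_norm_eq_inner)
  also have "\<dots> \<le> norm v * (sqrt (opnorm (transpose P ** P)) * norm ?w)"
    by (rule order_trans[OF norm_cauchy_schwarz]) (intro mult_left_mono norm_full_rank_le assms norm_ge_zero)
  finally show ?thesis using False by (simp add: mult_ac)
qed (simp add: opnorm_nonneg)

text \<open>For w the coarse vector on the left, P w is the A-orthogonal projection of v onto the
  range of \<open>P\<close>. Its squared energy norm equals P w . A v, and Cauchy-Schwarz leaves one
  factor to cancel.\<close>

lemma energy_norm_galerkin_projection_le:
  fixes P :: "real^'c^'n"
  assumes A: "spd A" and P: "inj ((*v) P)" and Ac: "Ac = transpose P ** A ** P"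
  shows "energy_norm Ac (matrix_inv Ac *v (transpose P *v (A *v v))) \<le> energy_norm A v"
proof -
  define w where "w = matrix_inv Ac *v (transpose P *v (A *v v))"
  have spd: "spd Ac" unfolding Ac by (rule spd_galerkin[OF A P])
  have "(energy_norm Ac w)\<^sup>2 = (P *v w) \<bullet> (A *v v)"
    using inner_transpose_mult[of P "A *v v" w]
    by (subst energy_norm_power2[OF spd]) (simp add: w_def spd_matrix_inv[OF spd] inner_commute)
  also have "\<dots> \<le> energy_norm Ac w * energy_norm A v"
    using energy_inner_le[OF A] by (simp add: Ac energy_norm_galerkin[OF A P])
  finally have "energy_norm Ac w * energy_norm Ac w \<le> energy_norm Ac w * energy_norm A v"
    by (simp add: power2_eq_square)
  then show ?thesis
    unfolding w_def[symmetric] using energy_norm_nonneg[of Ac w] energy_norm_nonneg[of A v]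
    by (cases "energy_norm Ac w = 0") (auto simp: mult_le_cancel_left)
qed

text \<open>Going through P z on the fine level replaces the smallest eigenvalue of
  \<open>Ac\<close> by those of the Gram matrix and of \<open>A\<close>, the quantities that enter
  \<mu>. The second bound is dual to the first.\<close>

lemma
  fixes P :: "real^'c^'n"
  assumes A: "spd A" and P: "inj ((*v) P)" and Ac: "Ac = transpose P ** A ** P"
  defines "k \<equiv> sqrt (opnorm (matrix_inv (transpose P ** P))) * sqrt (opnorm (matrix_inv A))"
  shows norm_le_energy_norm_galerkin: "norm z \<le> k * energy_norm Ac z"
    and energy_norm_galerkin_inv_le: "energy_norm Ac (matrix_inv Ac *v z) \<le> k * norm z"
proof -
  have spd: "spd Ac" unfolding Ac by (rule spd_galerkin[OF A P])
  show le: "norm z \<le> k * energy_norm Ac z" for z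
  proof -
    have "norm z \<le> sqrt (opnorm (matrix_inv (transpose P ** P))) * norm (P *v z)"
      by (rule norm_le_full_rank[OF P])
    also have "\<dots> \<le> sqrt (opnorm (matrix_inv (transpose P ** P))) *
        (sqrt (opnorm (matrix_inv A)) * energy_norm A (P *v z))"
      by (intro mult_left_mono norm_le_energy_norm A) (simp add: opnorm_nonneg)
    finally show ?thesis by (simp add: k_def Ac energy_norm_galerkin[OF A P])
  qed
  define w where "w = matrix_inv Ac *v z"
  have "(energy_norm Ac w)\<^sup>2 = w \<bullet> z"
    by (subst energy_norm_power2[OF spd]) (simp add: w_def spd_matrix_inv[OF spd])
  also have "\<dots> \<le> (k * energy_norm Ac w) * norm z"
    by (rule order_trans[OF norm_cauchy_schwarz]) (intro mult_right_mono le norm_ge_zero)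
  finally have "energy_norm Ac w * energy_norm Ac w \<le> energy_norm Ac w * (k * norm z)"
    by (simp add: power2_eq_square mult_ac)
  moreover have "0 \<le> k" by (simp add: k_def opnorm_nonneg)
  ultimately show "energy_norm Ac (matrix_inv Ac *v z) \<le> k * norm z"
    unfolding w_def[symmetric] using energy_norm_nonneg[of Ac w]
    by (cases "energy_norm Ac w = 0") (auto simp: mult_le_cancel_left)
qed

lemma energy_norm_near_identity_le:
  fixes B :: "real^'c^'c"
  assumes S: "spd S" and "energy_opnorm S (B - mat 1) \<le> 1"
  shows "energy_norm S (B *v z) \<le> 2 * energy_norm S z"
proof -
  have "energy_norm S ((B - mat 1) *v z) \<le> 1 * energy_norm S z"
    by (rule order_trans[OF energy_opnorm_bound[OF S]]) (intro mult_right_mono assms(2) energy_norm_nonneg)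
  moreover have "B *v z = (B - mat 1) *v z + z" by (simp add: matrix_vector_mult_diff_rdistrib)
  ultimately show ?thesis using energy_norm_add_le[of S "(B - mat 1) *v z" z] by simp
qed

lemma norm_le_of_abs_le:
  fixes u v :: "real^'n"
  assumes "\<bar>u\<bar> \<le> v"
  shows "norm u \<le> norm v"
  using assms by (intro norm_le_componentwise_cart) (auto simp: less_eq_vec_def abs_vec_def intro: order_trans)

lemma norm_abs_vec [simp]: "norm \<bar>v :: real^'n\<bar> = norm v"
  by (simp add: norm_vec_def abs_vec_def)

subsection \<open>The two-grid cycle\<close>

text \<open>In the units \<mu>, s = \<sigma>\<mu> and w = m(1 + \<sigma>)\<mu> the right side is
  4\<mu> + 3s + 2w + 2\<tau>\<mu>. Every term on the left is bounded linearly in the same units, and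
  the coefficients are then compared.\<close>

lemma two_grid_perturbation_budget:
  fixes \<epsilon> \<tau> \<mu> \<sigma> m \<beta> :: real
  assumes nonneg: "0 < \<epsilon>" "0 \<le> \<sigma>" "0 \<le> m" and le: "\<epsilon> \<le> \<tau>" "3 * \<tau> \<le> \<mu>"
    and \<beta>: "\<beta> = 2 + 3 * \<sigma> + 2 * m * (1 + \<sigma>)" and small: "(2 + \<beta>) * \<mu> < 1"
  defines "q \<equiv> m * \<epsilon> * (1 + \<epsilon>) * (1 + \<sigma>)" and "Q \<equiv> m * \<tau> * (1 + \<epsilon>) * (1 + \<sigma>)"
  defines "Y \<equiv> 1 + \<tau> + \<sigma> * \<epsilon> + q" and "Z \<equiv> 1 + \<tau> + \<sigma> * \<epsilon> + Q"
  shows "3 * (\<sigma> * \<epsilon>) + 2 * Q + 2 * (\<mu> * Y) + \<mu> / 3 * (2 * (Z + \<mu> * Y)) \<le> (2 + \<beta> + 2 * \<tau>) * \<mu>"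
proof -
  define s where "s = \<sigma> * \<mu>"
  define w where "w = m * (1 + \<sigma>) * \<mu>"
  have pos: "0 < \<tau>" "0 < \<mu>" using nonneg le by linarith+
  have sw: "0 \<le> s" "0 \<le> w" using nonneg pos by (simp_all add: s_def w_def)
  have "(2 + \<beta>) * \<mu> = 4 * \<mu> + 3 * s + 2 * w" by (simp add: \<beta> s_def w_def algebra_simps)
  then have b: "4 * \<mu> + 3 * s + 2 * w < 1" and goal: "(2 + \<beta> + 2 * \<tau>) * \<mu> = 4 * \<mu> + 3 * s + 2 * w + 2 * (\<tau> * \<mu>)"
    using small by (simp_all add: algebra_simps)
  \<comment> \<open>The numerical bounds follow from 4\<mu> < 1 together with \<epsilon> \<le>
    \<tau> \<le> \<mu>/3.\<close>
  have \<mu>4: "\<mu> \<le> 1/4" and \<tau>12: "\<tau> \<le> 1/12" and \<epsilon>12: "\<epsilon> \<le> 1/12" using b sw le by linarith+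
  have \<epsilon>\<mu>: "\<epsilon> \<le> \<mu> / 3" using le by linarith
  have s\<epsilon>: "\<sigma> * \<epsilon> \<le> s / 3" using mult_left_mono[OF \<epsilon>\<mu> nonneg(2)] by (simp add: s_def)
  have wm: "0 \<le> m * (1 + \<sigma>)" using nonneg by simp
  \<comment> \<open>The constant 13/36 below is the product of 1/3, from \<tau> \<le> \<mu>/3, and
    13/12, from 1 + \<epsilon>.\<close>
  have "m * (1 + \<sigma>) * (\<tau> * (1 + \<epsilon>)) \<le> m * (1 + \<sigma>) * ((\<mu> / 3) * (13 / 12))"
    using le \<epsilon>12 pos nonneg wm by (intro mult_left_mono mult_mono) auto
  then have Q: "Q \<le> 13 / 36 * w" by (simp add: Q_def w_def mult_ac)
  have "m * (1 + \<sigma>) * (1 + \<epsilon>) * \<epsilon> \<le> m * (1 + \<sigma>) * (1 + \<epsilon>) * \<tau>"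
    using le nonneg wm by (intro mult_left_mono) auto
  then have qQ: "q \<le> Q" by (simp add: q_def Q_def mult_ac)
  have Y: "Y \<le> Z" "Z \<le> 2" using qQ Q s\<epsilon> b sw pos \<tau>12 unfolding Y_def Z_def by linarith+
  have "\<mu> * (\<sigma> * \<epsilon>) \<le> s / 12"
    using mult_left_mono[OF \<epsilon>12 sw(1)] by (simp add: s_def mult_ac)
  moreover have "\<mu> * Q \<le> w / 11"
  proof -
    have "w * (\<tau> * (1 + \<epsilon>)) \<le> w * ((1 / 12) * (13 / 12))"
      using \<tau>12 \<epsilon>12 pos nonneg sw by (intro mult_left_mono mult_mono) auto
    also have "\<dots> \<le> w / 11" using sw by simp
    finally show ?thesis by (simp add: Q_def w_def mult_ac)
  qed
  moreover have "\<mu> * \<tau> \<le> \<mu> / 12"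
    using mult_left_mono[OF \<tau>12, of \<mu>] pos by simp
  moreover have "\<mu> * Z = \<mu> + \<mu> * \<tau> + \<mu> * (\<sigma> * \<epsilon>) + \<mu> * Q" by (simp add: Z_def algebra_simps)
  moreover have "\<mu> * Y \<le> \<mu> * Z" using Y pos by simp
  moreover have "\<mu> * (\<mu> * Y) \<le> \<mu> * (1 / 4 * 2)"
    using Y pos nonneg \<mu>4 by (intro mult_left_mono mult_mono) (auto simp: Y_def q_def)
  moreover have "\<mu> / 3 * (2 * (Z + \<mu> * Y)) = 2 / 3 * (\<mu> * Z) + 2 / 3 * (\<mu> * (\<mu> * Y))"
    by (simp add: algebra_simps)
  moreover have "0 \<le> \<tau> * \<mu>" using pos by simp
  ultimately show ?thesis using s\<epsilon> Q sw pos unfolding goal by linarith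
qed

theorem theorem7p2:
  fixes A M G T :: "real^'n^'n" and P :: "real^'c^'n" and Ac Bc :: "real^'c^'c"
    and mA mP :: nat and \<epsilon> \<epsilon>c \<zeta> \<alpha>M \<sigma> \<rho>tg_star :: real
    and \<tau> \<psi> mPp mAp \<mu> \<beta> \<phi> \<delta>\<rho> \<rho>tg :: real
    and flM :: "real^'n \<Rightarrow> real^'n" and r y :: "real^'n"
  assumes "spd A" and "row_nonzeros_le mA A"
    and "invertible M" and "G = mat 1 - M ** A" and "energy_opnorm A G < 1"
    and "CARD('c) < CARD('n)" and "rank P = CARD('c)"
    and "row_nonzeros_le mP P" and "row_nonzeros_le mP (transpose P)"
    and "\<forall>i j. P $ i $ j \<noteq> 0 \<longrightarrow> P $ i $ j > 0"
    and "Ac = transpose P ** A ** P"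
    and "T = mat 1 - P ** matrix_inv Ac ** transpose P ** A"
    and "energy_opnorm A (T ** G) < 1"
    and "energy_opnorm Ac (Bc - mat 1) < 1"
    and "0 \<le> \<rho>tg_star" and "\<rho>tg_star < 1"
    and "energy_opnorm A ((mat 1 - P ** Bc ** matrix_inv Ac ** transpose P ** A) ** G) \<le> \<rho>tg_star"
    and "0 < \<epsilon>" and "\<epsilon> < 1" and "\<epsilon>c = \<zeta> * \<epsilon>" and "\<zeta> \<ge> 1" and "0 < \<epsilon>c" and "\<epsilon>c < 1"
    and "real (mA + 1) * \<epsilon> < 1" and "real mP * \<epsilon> < 1"
    and "\<tau> = sqrt (cond_num A) * \<epsilon>" and "\<psi> = opnorm \<bar>A\<bar>"
    and "mPp = round_const mP \<epsilon>" and "mAp = round_const (mA + 1) \<epsilon>"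
    and "\<forall>z. \<exists>\<delta>M. flM z = M *v z + \<delta>M \<and> norm \<delta>M \<le> \<alpha>M * \<epsilon> * norm z"
    and "\<sigma> \<ge> (1 + \<epsilon>) * Max {\<alpha>M * opnorm A, \<psi> * \<alpha>M, \<psi> * opnorm M}"
    and "\<mu> = 3 * \<zeta> * sqrt (cond_num (transpose P ** P)) * mPp * \<tau>"
    and "\<beta> = 2 + 3 * \<sigma> + 2 * mAp * (1 + \<sigma>)"
    and "\<phi> = 2 * \<tau>\<^sup>2 + (4 + \<beta>) * \<mu> * \<tau> + 2 * \<mu> * \<tau>\<^sup>2"
    and "\<delta>\<rho> = 4 * \<tau> + (2 + \<beta>) * \<mu> + \<phi>"
    and "\<rho>tg = \<rho>tg_star + \<delta>\<rho>"
    and "\<delta>\<rho> < 1 - \<rho>tg_star"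
    and "two_grid_cycle A P Bc flM mA mP \<epsilon> \<epsilon>c r y"
  shows "energy_norm A (y - matrix_inv A *v r) \<le> \<rho>tg * energy_norm A (matrix_inv A *v r)"
proof -
  note spdA = assms(1) and Ac = assms(11)
  have P: "inj ((*v) P)" using assms(7) full_rank_injective by blast
  have spdAc: "spd Ac" unfolding Ac by (rule spd_galerkin[OF spdA P])
  have enAc: "energy_norm Ac z = energy_norm A (P *v z)" for z
    unfolding Ac by (rule energy_norm_galerkin[OF spdA P])
  note \<epsilon>pos = assms(18) and \<zeta>1 = assms(21)

  \<comment> \<open>Square roots of the condition numbers and signs of the parameters\<close>
  define a where "a = sqrt (opnorm A)"
  define a' where "a' = sqrt (opnorm (matrix_inv A))"
  define p where "p = sqrt (opnorm (transpose P ** P))"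
  define p' where "p' = sqrt (opnorm (matrix_inv (transpose P ** P)))"
  have ap_nonneg: "0 \<le> a" "0 \<le> a'" "0 \<le> p" "0 \<le> p'"
    by (simp_all add: a_def a'_def p_def p'_def opnorm_nonneg)
  \<comment> \<open>Each change between norms costs a single one of a, a', p, p'; splitting the
    condition numbers lets these factors recombine into \<tau> and \<mu>.\<close>
  have \<tau>: "\<tau> = a * a' * \<epsilon>" using assms(26) by (simp add: cond_num_def a_def a'_def real_sqrt_mult)
  have \<mu>: "\<mu> = 3 * \<zeta> * (p * p') * mPp * \<tau>"
    using assms(32) by (simp add: cond_num_def p_def p'_def real_sqrt_mult)
  have "1 \<le> sqrt (cond_num A)" "1 \<le> p * p'"
    using one_le_cond_num[OF spdA] one_le_cond_num[OF spd_gram[OF P]]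
    by (simp_all add: cond_num_def p_def p'_def flip: real_sqrt_mult)
  then have \<epsilon>\<tau>: "\<epsilon> \<le> \<tau>" and pp: "1 \<le> p * p'" using \<epsilon>pos assms(26) by simp_all

  \<comment> \<open>Full rank excludes P = 0, so some row has a nonzero entry; this makes
    \<open>mPp\<close> at least 1.\<close>
  have mP: "1 \<le> mP"
  proof (rule ccontr)
    assume "\<not> 1 \<le> mP"
    then have "{j. P $ i $ j \<noteq> 0} = {}" for i
      using assms(8) by (simp add: row_nonzeros_le_def not_le)
    then have "P = 0" by (simp add: vec_eq_iff)
    then show False using assms(7) by simp
  qed
  have "0 \<le> real mP * \<epsilon>" "1 \<le> real mP" using mP \<epsilon>pos by simp_all
  then have "1 - real mP * \<epsilon> \<le> real mP" by linarith
  then have mPp: "1 \<le> mPp"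
    using assms(25) by (simp add: assms(28) round_const_def le_divide_eq)
  have mAp: "0 \<le> mAp" using assms(24) by (simp add: assms(29) round_const_def)
  have "3 * 1 * 1 * 1 * \<tau> \<le> 3 * \<zeta> * (p * p') * mPp * \<tau>"
    using \<zeta>1 pp mPp \<epsilon>\<tau> \<epsilon>pos by (intro mult_mono) auto
  then have \<tau>\<mu>: "3 * \<tau> \<le> \<mu>" by (simp add: \<mu>)
  have \<tau>\<mu>_pos: "0 < \<tau>" "0 < \<mu>" using \<epsilon>pos \<epsilon>\<tau> \<tau>\<mu> by linarith+

  have \<sigma>: "(1 + \<epsilon>) * (\<alpha>M * opnorm A) \<le> \<sigma>" "(1 + \<epsilon>) * (\<psi> * \<alpha>M) \<le> \<sigma>" "(1 + \<epsilon>) * (\<psi> * opnorm M) \<le> \<sigma>"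
  proof -
    have "(1 + \<epsilon>) * t \<le> \<sigma>" if "t \<in> {\<alpha>M * opnorm A, \<psi> * \<alpha>M, \<psi> * opnorm M}" for t
      using that \<epsilon>pos by (intro order_trans[OF mult_left_mono[OF Max_ge] assms(31)]) auto
    then show "(1 + \<epsilon>) * (\<alpha>M * opnorm A) \<le> \<sigma>" "(1 + \<epsilon>) * (\<psi> * \<alpha>M) \<le> \<sigma>"
      "(1 + \<epsilon>) * (\<psi> * opnorm M) \<le> \<sigma>" by blast+
  qed
  have \<psi>: "0 \<le> \<psi>" unfolding assms(27) by (rule opnorm_nonneg)
  \<comment> \<open>The sign is read off the entry of the maximum that is a product of two
    norms.\<close>
  have \<sigma>_nonneg: "0 \<le> \<sigma>"
    using \<sigma>(3) \<psi> \<epsilon>pos by (intro order_trans[OF _ \<sigma>(3)]) (simp add: opnorm_nonneg)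

  obtain r0 yh rtg bc dc d \<delta>0 \<delta>1 \<delta>3 \<delta>4 \<delta>5 where
    r0: "r0 = r + \<delta>0" "norm \<delta>0 \<le> \<epsilon> * norm r" and
    yh: "yh = flM r0" and
    rtg: "rtg = A *v yh - r0 + \<delta>1" and
    \<delta>1: "\<bar>\<delta>1\<bar> \<le> (mAp * \<epsilon>) *\<^sub>R (\<bar>r0\<bar> + \<bar>A\<bar> *v \<bar>yh\<bar>)" and
    bc: "bc = transpose P *v rtg + \<delta>3" and
    \<delta>3: "\<bar>\<delta>3\<bar> \<le> (\<epsilon>c + (1 + \<epsilon>c) * mPp * \<epsilon>) *\<^sub>R (transpose P *v \<bar>rtg\<bar>)" and
    dc: "dc = Bc *v (matrix_inv Ac *v bc)" and
    d: "d = P *v dc + \<delta>5" and \<delta>5: "\<bar>\<delta>5\<bar> \<le> (mPp * \<epsilon>c) *\<^sub>R (P *v \<bar>dc\<bar>)" and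
    y: "\<And>i. y $ i = (yh - d) $ i * (1 + \<delta>4 $ i)" "\<And>i. \<bar>\<delta>4 $ i\<bar> \<le> \<epsilon>"
    using assms(38) unfolding two_grid_cycle_def Ac[symmetric] assms(28,29) by metis
  obtain \<delta>M where \<delta>M: "yh = M *v r0 + \<delta>M" "norm \<delta>M \<le> \<alpha>M * \<epsilon> * norm r0"
    using assms(30) yh by blast

  define x where "x = matrix_inv A *v r"
  \<comment> \<open>The exact solution for the rounded right-hand side: measured against it,
    relaxation and residual see no error from the initial rounding.\<close>
  define x0 where "x0 = matrix_inv A *v r0"
  define E where "E = energy_norm A x"
  \<comment> \<open>Relative to E, the residual error has Euclidean size a q; its coarse correction
    costs a further a', which turns \<epsilon> into \<tau> and q into Q. Y measures the Euclidean
    residual relative to a E, and Z the energy norm of the coarse correction before the restriction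
    error.\<close>
  define q where "q = mAp * \<epsilon> * (1 + \<epsilon>) * (1 + \<sigma>)"
  define Q where "Q = mAp * \<tau> * (1 + \<epsilon>) * (1 + \<sigma>)"
  define Y where "Y = 1 + \<tau> + \<sigma> * \<epsilon> + q"
  define Z where "Z = 1 + \<tau> + \<sigma> * \<epsilon> + Q"
  have E: "0 \<le> E" by (simp add: E_def)
  have Ax0: "A *v x0 = r0" by (simp add: x0_def spd_matrix_inv[OF spdA])
  have qQ_nonneg: "0 \<le> q" "0 \<le> Q" using mAp \<epsilon>pos \<sigma>_nonneg \<tau>\<mu>_pos by (simp_all add: q_def Q_def)
  have Q: "a' * (a * q) = Q" by (simp add: q_def Q_def \<tau> mult_ac)

  \<comment> \<open>Fine-level errors: right-hand side, relaxation and residual\<close>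
  have r: "norm r \<le> a * E"
    using norm_mult_le_energy_norm[OF spdA, of x] by (simp add: a_def E_def x_def spd_matrix_inv[OF spdA])
  have d0: "norm \<delta>0 \<le> \<epsilon> * (a * E)"
    using r \<epsilon>pos by (intro order_trans[OF r0(2)] mult_left_mono) auto
  have r0_le: "norm r0 \<le> (1 + \<epsilon>) * (a * E)"
    using norm_triangle_ineq[of r \<delta>0] r d0 r0(1) by (simp add: algebra_simps)
  have x0_x: "energy_norm A (x0 - x) \<le> \<tau> * E"
  proof -
    have "x0 - x = matrix_inv A *v \<delta>0"
      by (simp add: x0_def x_def r0(1) matrix_vector_right_distrib)
    then have "energy_norm A (x0 - x) \<le> a' * norm \<delta>0"
      using energy_norm_inv_le_norm[OF spdA] by (simp add: a'_def)
    also have "\<dots> \<le> a' * (\<epsilon> * (a * E))" using d0 ap_nonneg by (intro mult_left_mono) auto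
    finally show ?thesis by (simp add: \<tau> mult_ac)
  qed
  have x0_le: "energy_norm A x0 \<le> (1 + \<tau>) * E"
    using energy_norm_add_le[of A x "x0 - x"] x0_x by (simp add: E_def algebra_simps)

  \<comment> \<open>The factor 1 + \<epsilon> in the bound on \<sigma> cancels the one in the bound
    for \<open>r0\<close>. Here t stands for the norm of \<open>A\<close> or for \<psi>.\<close>
  have \<alpha>r0: "t * norm \<delta>M \<le> \<sigma> * \<epsilon> * (a * E)" if "(1 + \<epsilon>) * (t * \<alpha>M) \<le> \<sigma>" "0 \<le> t" for t
  proof -
    have "t * norm \<delta>M \<le> (t * \<alpha>M) * (\<epsilon> * norm r0)"
      using mult_left_mono[OF \<delta>M(2) that(2)] by (simp add: mult_ac)
    also have "\<dots> \<le> (\<sigma> / (1 + \<epsilon>)) * (\<epsilon> * norm r0)"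
      using that \<epsilon>pos by (intro mult_right_mono) (auto simp: field_simps)
    also have "\<dots> \<le> (\<sigma> / (1 + \<epsilon>)) * (\<epsilon> * ((1 + \<epsilon>) * (a * E)))"
      using r0_le \<epsilon>pos \<sigma>_nonneg by (intro mult_left_mono) auto
    also have "\<dots> = \<sigma> * \<epsilon> * (a * E)" using \<epsilon>pos by simp
    finally show ?thesis .
  qed
  have dM: "energy_norm A \<delta>M \<le> \<sigma> * \<epsilon> * E"
  proof -
    have "0 < a" using \<tau> \<tau>\<mu>_pos ap_nonneg by (cases "a = 0") auto
    \<comment> \<open>Multiplying by a once more produces the full norm of \<open>A\<close>, to
      which \<sigma> refers; the extra a is then cancelled.\<close>
    moreover have "a * (a * norm \<delta>M) \<le> a * (\<sigma> * \<epsilon> * E)"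
      using \<alpha>r0[of "opnorm A"] \<sigma>(1) by (simp add: a_def opnorm_nonneg mult_ac)
    ultimately have "a * norm \<delta>M \<le> \<sigma> * \<epsilon> * E" by simp
    then show ?thesis using energy_norm_le_norm[OF spdA, of \<delta>M] by (simp add: a_def)
  qed
  have yh_le: "\<psi> * norm yh \<le> \<sigma> * (1 + \<epsilon>) * (a * E)"
  proof -
    have "\<psi> * norm (M *v r0) \<le> (\<psi> * opnorm M) * norm r0"
      using mult_left_mono[OF norm_mult_opnorm_le \<psi>, of M r0] by (simp add: mult_ac)
    also have "\<dots> \<le> (\<psi> * opnorm M) * ((1 + \<epsilon>) * (a * E))"
      using r0_le \<psi> by (intro mult_left_mono) (auto simp: opnorm_nonneg)
    also have "\<dots> \<le> \<sigma> * (a * E)"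
      using mult_right_mono[OF \<sigma>(3), of "a * E"] ap_nonneg E by (simp add: mult_ac)
    finally have "\<psi> * norm (M *v r0) \<le> \<sigma> * (a * E)" .
    moreover have "\<psi> * norm yh \<le> \<psi> * norm (M *v r0) + \<psi> * norm \<delta>M"
      using mult_left_mono[OF norm_triangle_ineq[of "M *v r0" \<delta>M] \<psi>] by (simp add: \<delta>M(1) algebra_simps)
    ultimately show ?thesis using \<alpha>r0[OF \<sigma>(2) \<psi>] by (simp add: algebra_simps)
  qed
  have d1: "norm \<delta>1 \<le> a * q * E"
  proof -
    have "norm (\<bar>r0\<bar> + \<bar>A\<bar> *v \<bar>yh\<bar>) \<le> norm r0 + \<psi> * norm yh"
      using norm_triangle_ineq[of "\<bar>r0\<bar>" "\<bar>A\<bar> *v \<bar>yh\<bar>"] norm_mult_opnorm_le[of "\<bar>A\<bar>" "\<bar>yh\<bar>"]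
      by (simp add: assms(27))
    also have "\<dots> \<le> (1 + \<sigma>) * (1 + \<epsilon>) * (a * E)" using r0_le yh_le by (simp add: algebra_simps)
    finally have "(mAp * \<epsilon>) * norm (\<bar>r0\<bar> + \<bar>A\<bar> *v \<bar>yh\<bar>) \<le> (mAp * \<epsilon>) * ((1 + \<sigma>) * (1 + \<epsilon>) * (a * E))"
      using mAp \<epsilon>pos by (intro mult_left_mono) auto
    moreover have "norm \<delta>1 \<le> (mAp * \<epsilon>) * norm (\<bar>r0\<bar> + \<bar>A\<bar> *v \<bar>yh\<bar>)"
      using norm_le_of_abs_le[OF \<delta>1] mAp \<epsilon>pos by simp
    ultimately show ?thesis by (simp add: q_def mult_ac)
  qed
  have a'd1: "a' * norm \<delta>1 \<le> Q * E"
    using mult_left_mono[OF d1 ap_nonneg(2)] Q by (simp add: mult_ac)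

  have G: "G *v x0 = x0 - M *v r0"
    by (simp add: assms(4) matrix_vector_mult_diff_rdistrib Ax0 flip: matrix_vector_mul_assoc)
  have yh_x0: "yh - x0 = \<delta>M - G *v x0" by (simp add: \<delta>M(1) G)
  have "energy_norm A (G *v x0) \<le> 1 * energy_norm A x0"
    by (rule order_trans[OF energy_opnorm_bound[OF spdA] mult_right_mono]) (use assms(5) in auto)
  then have yh_x0_le: "energy_norm A (yh - x0) \<le> (1 + \<tau> + \<sigma> * \<epsilon>) * E"
    unfolding yh_x0 using energy_norm_diff_le[of A \<delta>M "G *v x0"] x0_le dM
    by (simp add: algebra_simps)
  have rtg': "rtg = A *v (yh - x0) + \<delta>1" by (simp add: rtg matrix_vector_mult_diff_distrib Ax0)
  have rtg_le: "norm rtg \<le> a * (Y * E)"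
  proof -
    have "norm rtg \<le> a * energy_norm A (yh - x0) + norm \<delta>1"
      using norm_triangle_ineq[of "A *v (yh - x0)" \<delta>1] norm_mult_le_energy_norm[OF spdA, of "yh - x0"]
      unfolding rtg' a_def by linarith
    also have "\<dots> \<le> a * ((1 + \<tau> + \<sigma> * \<epsilon>) * E) + a * q * E"
      using yh_x0_le d1 ap_nonneg by (intro add_mono mult_left_mono) auto
    finally show ?thesis by (simp add: Y_def algebra_simps)
  qed

  \<comment> \<open>Restriction, coarse correction and interpolation\<close>
  define k where "k = p' * a'"
  have d3: "k * norm \<delta>3 \<le> \<mu> * Y * E"
  proof -
    define c where "c = \<epsilon>c + (1 + \<epsilon>c) * mPp * \<epsilon>"
    \<comment> \<open>Each of the three summands of c is at most \<zeta> \<open>mPp\<close>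
      \<epsilon>, the mixed one because \<epsilon>c < 1. This is the source of the 3 in
      \<mu>.\<close>
    have "\<epsilon>c \<le> \<zeta> * mPp * \<epsilon>" "mPp * \<epsilon> \<le> \<zeta> * mPp * \<epsilon>"
      using assms(20) mPp \<zeta>1 \<epsilon>pos by simp_all
    moreover have "\<epsilon>c * (mPp * \<epsilon>) \<le> 1 * (mPp * \<epsilon>)"
      using assms(23) mPp \<epsilon>pos by (intro mult_right_mono) auto
    ultimately have c: "c \<le> 3 * \<zeta> * mPp * \<epsilon>" by (simp add: c_def algebra_simps)
    have c0: "0 \<le> c" using assms(22) mPp \<epsilon>pos by (simp add: c_def)
    have "norm \<delta>3 \<le> c * norm (transpose P *v \<bar>rtg\<bar>)"
      using norm_le_of_abs_le[OF \<delta>3] c0 by (simp add: c_def)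
    also have "\<dots> \<le> (3 * \<zeta> * mPp * \<epsilon>) * (p * norm rtg)"
      using norm_transpose_full_rank_le[OF P, of "\<bar>rtg\<bar>"] c c0 order_trans[OF c0 c]
      by (intro mult_mono) (auto simp: p_def)
    also have "\<dots> \<le> (3 * \<zeta> * mPp * \<epsilon>) * (p * (a * (Y * E)))"
      using rtg_le \<zeta>1 mPp \<epsilon>pos ap_nonneg by (intro mult_left_mono) auto
    finally have "k * norm \<delta>3 \<le> k * ((3 * \<zeta> * mPp * \<epsilon>) * (p * (a * (Y * E))))"
      using ap_nonneg by (intro mult_left_mono) (auto simp: k_def)
    then show ?thesis by (simp add: k_def \<mu> \<tau> mult_ac)
  qed

  define N where "N v = matrix_inv Ac *v (transpose P *v v)" for v
  have N_A: "energy_norm Ac (N (A *v v)) \<le> energy_norm A v" for v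
    unfolding N_def by (rule energy_norm_galerkin_projection_le[OF spdA P Ac])
  have N_le: "energy_norm Ac (N v) \<le> a' * norm v" for v
    using N_A[of "matrix_inv A *v v"] energy_norm_inv_le_norm[OF spdA, of v]
    by (simp add: spd_matrix_inv[OF spdA] a'_def)
  have inv3: "energy_norm Ac (matrix_inv Ac *v \<delta>3) \<le> \<mu> * Y * E"
    using energy_norm_galerkin_inv_le[OF spdA P Ac, of \<delta>3] d3 by (simp add: k_def p'_def a'_def)
  have Bc: "energy_norm Ac (Bc *v z) \<le> 2 * energy_norm Ac z" for z
    using assms(14) by (intro energy_norm_near_identity_le[OF spdAc]) simp
  have dc': "dc = Bc *v (N (A *v (yh - x0)) + N \<delta>1 + matrix_inv Ac *v \<delta>3)"
    by (simp add: dc bc rtg' N_def matrix_vector_right_distrib)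
  have dc_le: "energy_norm Ac dc \<le> 2 * (Z + \<mu> * Y) * E"
  proof -
    have "energy_norm Ac (N (A *v (yh - x0)) + N \<delta>1 + matrix_inv Ac *v \<delta>3)
        \<le> energy_norm Ac (N (A *v (yh - x0))) + energy_norm Ac (N \<delta>1) + energy_norm Ac (matrix_inv Ac *v \<delta>3)"
      by (intro order_trans[OF energy_norm_add_le] add_mono energy_norm_add_le order_refl)
    also have "\<dots> \<le> (1 + \<tau> + \<sigma> * \<epsilon>) * E + Q * E + \<mu> * Y * E"
      using N_A[of "yh - x0"] yh_x0_le N_le[of \<delta>1] a'd1 inv3 by linarith
    also have "\<dots> = (Z + \<mu> * Y) * E" by (simp add: Z_def algebra_simps)
    finally show ?thesis
      unfolding dc' by (intro order_trans[OF Bc]) (simp add: distrib_right)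
  qed
  \<comment> \<open>The interpolation error has a single factor \<open>mPp * \<epsilon>c\<close>
    where restriction had three summands, hence \<mu>/3.\<close>
  have d5: "energy_norm A \<delta>5 \<le> \<mu> / 3 * (2 * (Z + \<mu> * Y)) * E"
  proof -
    have "norm \<delta>5 \<le> (mPp * \<epsilon>c) * norm (P *v \<bar>dc\<bar>)"
      using norm_le_of_abs_le[OF \<delta>5] mPp assms(22) by simp
    also have "\<dots> \<le> (mPp * \<epsilon>c) * (p * (k * energy_norm Ac dc))"
    proof (intro mult_left_mono)
      have "norm (P *v \<bar>dc\<bar>) \<le> p * norm dc"
        using norm_full_rank_le[OF P, of "\<bar>dc\<bar>"] by (simp add: p_def)
      also have "\<dots> \<le> p * (k * energy_norm Ac dc)"
        using norm_le_energy_norm_galerkin[OF spdA P Ac, of dc] ap_nonneg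
        by (intro mult_left_mono) (auto simp: k_def p'_def a'_def)
      finally show "norm (P *v \<bar>dc\<bar>) \<le> p * (k * energy_norm Ac dc)" .
    qed (use mPp assms(22) in auto)
    finally have "a * norm \<delta>5 \<le> a * ((mPp * \<epsilon>c) * (p * (k * energy_norm Ac dc)))"
      using ap_nonneg by (intro mult_left_mono)
    also have "\<dots> = \<mu> / 3 * energy_norm Ac dc" by (simp add: \<mu> \<tau> k_def assms(20) mult_ac)
    also have "\<dots> \<le> \<mu> / 3 * (2 * (Z + \<mu> * Y) * E)"
      using dc_le \<tau>\<mu>_pos by (intro mult_left_mono) auto
    finally show ?thesis
      using energy_norm_le_norm[OF spdA, of \<delta>5] by (simp add: a_def mult_ac)
  qed

  \<comment> \<open>The error before the final update\<close>
  define C where "C v = P *v (Bc *v v)" for v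
  have C_le: "energy_norm A (C z) \<le> 2 * energy_norm Ac z" for z
    unfolding C_def enAc[symmetric] by (rule Bc)
  define K where "K = mat 1 - P ** Bc ** matrix_inv Ac ** transpose P ** A"
  have K: "K *v v = v - C (N (A *v v))" for v
    by (simp add: K_def C_def N_def matrix_vector_mult_diff_rdistrib flip: matrix_vector_mul_assoc)
  define e where "e = yh - d - x"
  have "e = K *v (yh - x0) + (x0 - x) - C (N \<delta>1) - C (matrix_inv Ac *v \<delta>3) - \<delta>5"
    by (simp add: e_def d dc' K C_def matrix_vector_right_distrib)
  \<comment> \<open>Only the \<open>K ** G\<close> part is covered by \<open>\<rho>tg_star\<close>.
    The relaxation error and its coarse correction are estimated separately, with factors 1 and 2,
    giving 3\<sigma>\<epsilon>.\<close>
  moreover have "K *v (yh - x0) = \<delta>M - C (N (A *v \<delta>M)) - (K ** G) *v x0"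
    by (simp add: yh_x0 matrix_vector_mult_diff_distrib K flip: matrix_vector_mul_assoc)
  ultimately have "e = \<delta>M - C (N (A *v \<delta>M)) - (K ** G) *v x0 + (x0 - x)
      - C (N \<delta>1) - C (matrix_inv Ac *v \<delta>3) - \<delta>5" by simp
  then have "energy_norm A e \<le> energy_norm A \<delta>M + energy_norm A (C (N (A *v \<delta>M)))
      + energy_norm A ((K ** G) *v x0) + energy_norm A (x0 - x) + energy_norm A (C (N \<delta>1))
      + energy_norm A (C (matrix_inv Ac *v \<delta>3)) + energy_norm A \<delta>5"
    by (simp only:) (intro order_trans[OF energy_norm_diff_le] order_trans[OF energy_norm_add_le]
      add_mono energy_norm_diff_le order_refl)
  moreover have "energy_norm A (C (N (A *v \<delta>M))) \<le> 2 * (\<sigma> * \<epsilon> * E)"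
    using C_le[of "N (A *v \<delta>M)"] N_A[of \<delta>M] dM by linarith
  moreover have "energy_norm A ((K ** G) *v x0) \<le> \<rho>tg_star * ((1 + \<tau>) * E)"
    using energy_opnorm_bound[OF spdA, of "K ** G" x0] assms(17) x0_le assms(15)
    unfolding K_def[symmetric]
    by (meson mult_mono order_trans energy_norm_nonneg)
  moreover have "energy_norm A (C (N \<delta>1)) \<le> 2 * (Q * E)"
    using C_le[of "N \<delta>1"] N_le[of \<delta>1] a'd1 by linarith
  moreover have "energy_norm A (C (matrix_inv Ac *v \<delta>3)) \<le> 2 * (\<mu> * Y * E)"
    using C_le[of "matrix_inv Ac *v \<delta>3"] inv3 by linarith
  ultimately have "energy_norm A e \<le> \<rho>tg_star * ((1 + \<tau>) * E) + \<tau> * E + 3 * (\<sigma> * \<epsilon> * E)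
      + 2 * (Q * E) + 2 * (\<mu> * Y * E) + \<mu> / 3 * (2 * (Z + \<mu> * Y)) * E"
    using dM x0_x d5 by linarith
  also have "\<dots> = (\<rho>tg_star * (1 + \<tau>) + \<tau> +
      (3 * (\<sigma> * \<epsilon>) + 2 * Q + 2 * (\<mu> * Y) + \<mu> / 3 * (2 * (Z + \<mu> * Y)))) * E"
    by (simp add: algebra_simps)
  also have "\<dots> \<le> (\<rho>tg_star + 2 * \<tau> + (2 + \<beta> + 2 * \<tau>) * \<mu>) * E"
  proof (rule mult_right_mono[OF _ E])
    have "0 \<le> \<beta>" using assms(33) \<sigma>_nonneg mAp by simp
    then have "0 \<le> \<phi>" using \<tau>\<mu>_pos by (simp add: assms(34))
    \<comment> \<open>The remaining summands of \<open>\<delta>\<rho>\<close> and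
      \<open>\<rho>tg_star\<close> are nonnegative, so the smallness assumption bounds this summand
      alone by 1.\<close>
    then have "(2 + \<beta>) * \<mu> < 1" using assms(15,35,37) \<tau>\<mu>_pos by linarith
    from two_grid_perturbation_budget[OF \<epsilon>pos \<sigma>_nonneg mAp \<epsilon>\<tau> \<tau>\<mu> assms(33) this]
    have "3 * (\<sigma> * \<epsilon>) + 2 * Q + 2 * (\<mu> * Y) + \<mu> / 3 * (2 * (Z + \<mu> * Y)) \<le> (2 + \<beta> + 2 * \<tau>) * \<mu>"
      unfolding Y_def Z_def q_def Q_def .
    moreover have "\<rho>tg_star * \<tau> \<le> \<tau>"
      using assms(16) \<tau>\<mu>_pos by (simp add: mult_le_cancel_right1)
    moreover have "\<rho>tg_star * (1 + \<tau>) = \<rho>tg_star + \<rho>tg_star * \<tau>" by (simp add: distrib_left)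
    ultimately show "\<rho>tg_star * (1 + \<tau>) + \<tau> +
        (3 * (\<sigma> * \<epsilon>) + 2 * Q + 2 * (\<mu> * Y) + \<mu> / 3 * (2 * (Z + \<mu> * Y)))
        \<le> \<rho>tg_star + 2 * \<tau> + (2 + \<beta> + 2 * \<tau>) * \<mu>"
      by linarith
  qed
  finally have e_le: "energy_norm A e \<le> (\<rho>tg_star + 2 * \<tau> + (2 + \<beta> + 2 * \<tau>) * \<mu>) * E" .

  \<comment> \<open>The final update\<close>
  have "energy_norm A (y - (yh - d)) \<le> \<tau> * energy_norm A (yh - d)"
  proof -
    \<comment> \<open>The entrywise factor is controlled in the Euclidean norm; converting from the
      energy norm and back costs a a', which turns \<epsilon> into \<tau>.\<close>
    have "norm (y - (yh - d)) \<le> norm (\<epsilon> *\<^sub>R (yh - d))"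
    proof (rule norm_le_componentwise_cart)
      fix i
      have "(y - (yh - d)) $ i = \<delta>4 $ i * (yh - d) $ i"
        by (simp add: y(1) algebra_simps)
      then show "norm ((y - (yh - d)) $ i) \<le> norm ((\<epsilon> *\<^sub>R (yh - d)) $ i)"
        using y(2)[of i] \<epsilon>pos by (simp add: abs_mult mult_right_mono)
    qed
    also have "\<dots> \<le> \<epsilon> * (a' * energy_norm A (yh - d))"
      using norm_le_energy_norm[OF spdA, of "yh - d"] \<epsilon>pos by (simp add: a'_def)
    finally have "a * norm (y - (yh - d)) \<le> a * (\<epsilon> * (a' * energy_norm A (yh - d)))"
      using ap_nonneg by (intro mult_left_mono)
    then show ?thesis
      using energy_norm_le_norm[OF spdA, of "y - (yh - d)"] by (simp add: a_def \<tau> mult_ac)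
  qed
  also have "\<dots> \<le> \<tau> * (energy_norm A e + E)"
    using energy_norm_add_le[of A e x] \<tau>\<mu>_pos by (simp add: e_def E_def)
  finally have "energy_norm A (y - x) \<le> (1 + \<tau>) * energy_norm A e + \<tau> * E"
    using energy_norm_add_le[of A "y - (yh - d)" e] by (simp add: e_def algebra_simps)
  also have "\<dots> \<le> (1 + \<tau>) * ((\<rho>tg_star + 2 * \<tau> + (2 + \<beta> + 2 * \<tau>) * \<mu>) * E) + \<tau> * E"
    using e_le \<tau>\<mu>_pos by (intro add_mono mult_left_mono) auto
  also have "\<dots> = ((1 + \<tau>) * (\<rho>tg_star + 2 * \<tau> + (2 + \<beta> + 2 * \<tau>) * \<mu>) + \<tau>) * E"
    by (simp add: algebra_simps)
  also have "\<dots> \<le> \<rho>tg * E"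
  proof (rule mult_right_mono[OF _ E])
    have "\<rho>tg_star * \<tau> \<le> \<tau>"
      using assms(16) \<tau>\<mu>_pos by (simp add: mult_le_cancel_right1)
    \<comment> \<open>Expanding the product reproduces \<open>\<rho>tg\<close> term by term, except
      that 3\<tau> + \<open>\<rho>tg_star * \<tau>\<close> is rounded up to 4\<tau>.\<close>
    then show "(1 + \<tau>) * (\<rho>tg_star + 2 * \<tau> + (2 + \<beta> + 2 * \<tau>) * \<mu>) + \<tau> \<le> \<rho>tg"
      by (simp add: assms(34,35,36) power2_eq_square algebra_simps)
  qed
  finally show ?thesis by (simp add: E_def x_def)
qed

end
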